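(* Let $k$ and $m$ be positive integers. The following are equivalent: (i) there is a cover $\mathcal S=\{S_0,\ldots,S_m\}$ of $\mathbb S^k$ such that $\bigcap_{i=0}^m S_i=\emptyset$ and such that for every cover $\mathcal F=\{F_0,\ldots,F_m\}$ of $\mathbb B^{k+1}$ that extends $\mathcal S$ one has $\bigcap_{i=0}^m F_i\neq\emptyset$; (ii) $\pi_k(\mathbb S^{m-1})\neq 0$.
   Context: $\mathbb S^n$ is the $n$-dimensional unit sphere, $\mathbb B^n$ is the $n$-dimensional unit disk, and $\mathbb S^k=\partial\mathbb B^{k+1}$. A cover of a space is a finite indexed family of subsets whose union is the space and which consists either entirely of open sets or entirely of closed sets (an open, respectively closed, cover). If $A\subset X$, $\mathcal S=\{S_0,\ldots,S_m\}$ is a cover of $A$ and $\mathcal F=\{F_0,\ldots,F_m\}$ is a cover of $X$, then $\mathcal F$ extends $\mathcal S$ if $\mathcal F$ is open when $\mathcal S$ is open, $\mathcal F$ is closed when $\mathcal S$ is closed, and $S_i=F_i\cap A$ for all $i$. *)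

theory Defs
  imports "HOL-Analysis.Analysis" "HOL-Algebra.Group"
begin

text \<open>
  A family indexed by \<open>0, \<dots>, m\<close> is a function on \<open>nat\<close> whose values beyond \<open>m\<close> are ignored.
  Openness and closedness are relative to the covered space; both imply \<open>S i \<subseteq> X\<close>.
\<close>

definition open_cover :: "nat \<Rightarrow> 'a::topological_space set \<Rightarrow> (nat \<Rightarrow> 'a set) \<Rightarrow> bool" where
  "open_cover m X S \<longleftrightarrow> (\<forall>i\<le>m. openin (top_of_set X) (S i)) \<and> (\<Union>i\<le>m. S i) = X"

definition closed_cover :: "nat \<Rightarrow> 'a::topological_space set \<Rightarrow> (nat \<Rightarrow> 'a set) \<Rightarrow> bool" where
  "closed_cover m X S \<longleftrightarrow> (\<forall>i\<le>m. closedin (top_of_set X) (S i)) \<and> (\<Union>i\<le>m. S i) = X"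

definition cover :: "nat \<Rightarrow> 'a::topological_space set \<Rightarrow> (nat \<Rightarrow> 'a set) \<Rightarrow> bool" where
  "cover m X S \<longleftrightarrow> open_cover m X S \<or> closed_cover m X S"

definition cover_extends ::
    "nat \<Rightarrow> 'a::topological_space set \<Rightarrow> (nat \<Rightarrow> 'a set) \<Rightarrow> 'a set \<Rightarrow> (nat \<Rightarrow> 'a set) \<Rightarrow> bool" where
  "cover_extends m X F A S \<longleftrightarrow>
     A \<subseteq> X \<and> cover m A S \<and> cover m X F \<and>
     (open_cover m A S \<longrightarrow> open_cover m X F) \<and>
     (closed_cover m A S \<longrightarrow> closed_cover m X F) \<and>
     (\<forall>i\<le>m. S i = F i \<inter> A)"

definition unit_cube :: "nat \<Rightarrow> (nat \<Rightarrow> real) topology" where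
  "unit_cube k = product_topology (\<lambda>_. top_of_set {0..1}) {..<k}"

definition cube_boundary :: "nat \<Rightarrow> (nat \<Rightarrow> real) set" where
  "cube_boundary k = {t \<in> topspace (unit_cube k). \<exists>i<k. t i = 0 \<or> t i = 1}"

definition spheroids :: "nat \<Rightarrow> 'a topology \<Rightarrow> 'a \<Rightarrow> ((nat \<Rightarrow> real) \<Rightarrow> 'a) set" where
  "spheroids k X x0 =
     {f. continuous_map (unit_cube k) X f \<and> (\<forall>t\<in>cube_boundary k. f t = x0)}"

text \<open>
  Homotopy is relative to the boundary of the cube. Functions that agree on the cube are
  identified, so values outside it do not matter.
\<close>

definition spheroid_class ::
    "nat \<Rightarrow> 'a topology \<Rightarrow> 'a \<Rightarrow> ((nat \<Rightarrow> real) \<Rightarrow> 'a) \<Rightarrow> ((nat \<Rightarrow> real) \<Rightarrow> 'a) set" where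
  "spheroid_class k X x0 f =
     {g. homotopic_with (\<lambda>h. \<forall>t\<in>cube_boundary k. h t = x0) (unit_cube k) X f g}"

definition spheroid_join ::
    "((nat \<Rightarrow> real) \<Rightarrow> 'a) \<Rightarrow> ((nat \<Rightarrow> real) \<Rightarrow> 'a) \<Rightarrow> (nat \<Rightarrow> real) \<Rightarrow> 'a" where
  "spheroid_join f g =
     (\<lambda>t. if t 0 \<le> 1/2 then f (t(0 := 2 * t 0)) else g (t(0 := 2 * t 0 - 1)))"

text \<open>
  The homotopy group \<open>\<pi>\<^sub>k(X, x0)\<close>, for \<open>k \<ge> 1\<close> and \<open>x0\<close> a point of \<open>X\<close>. The union in the
  product is over representatives, all of whose joins lie in the same class.
\<close>

definition homotopy_group ::
    "nat \<Rightarrow> 'a topology \<Rightarrow> 'a \<Rightarrow> ((nat \<Rightarrow> real) \<Rightarrow> 'a) set monoid" where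
  "homotopy_group k X x0 =
     \<lparr>carrier = spheroid_class k X x0 ` spheroids k X x0,
      mult = (\<lambda>P Q. \<Union>f\<in>P. \<Union>g\<in>Q. spheroid_class k X x0 (spheroid_join f g)),
      one = spheroid_class k X x0 (\<lambda>_. x0)\<rparr>"

end

(*
  A family of m + 1 nonnegative functions on X, at each point not all zero but with some zero, is the
  same as a map from X to R^m - {0}, by a |-> (a_i - a_m)_i. Distance functions turn a cover with
  empty intersection into such a family and the zero (or positivity) sets of a family form such a
  cover. So a cover S with no disjoint extension to the ball is the same as a map
  S^k -> R^m - {0}, up to homotopy S^k -> S^(m-1), that does not extend to the ball.

  For the homotopy group, regard a spheroid as a map on the boundary of [0,1]^(k+1) that is constant
  off the bottom face. A homotopy rel boundary to the constant spheroid is an extension to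
  [0,1]^(k+1). Conversely every map on the boundary of the cube is homotopic to one that is constant
  off the bottom face, as those faces lie in the boundary minus a point, which is contractible; a
  rotation of the target moves that constant to the base point.
*)
theory Submission
  imports Defs
begin

text \<open>Homotopy is free and the constant may depend on the map, so the notion also suits
  targets that are not path-connected, such as the 0-sphere for m = 1. This form of triviality is
  invariant under homotopy equivalence in either argument.\<close>

definition all_maps_null :: "'a::topological_space set \<Rightarrow> 'b::topological_space set \<Rightarrow> bool" where
  "all_maps_null S U \<longleftrightarrow>
     (\<forall>f. continuous_on S f \<and> f \<in> S \<rightarrow> U \<longrightarrow> (\<exists>c. homotopic_with_canon (\<lambda>x. True) S U f (\<lambda>x. c)))"

lemma all_maps_null_domain_cong:
  fixes S :: "'a::real_normed_vector set" and T :: "'b::real_normed_vector set"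
    and U :: "'c::real_normed_vector set"
  assumes "S homotopy_eqv T"
  shows "all_maps_null S U \<longleftrightarrow> all_maps_null T U"
  unfolding all_maps_null_def by (rule homotopy_eqv_cohomotopic_triviality_null [OF assms])

lemma all_maps_null_codomain_cong:
  fixes S :: "'a::real_normed_vector set" and T :: "'b::real_normed_vector set"
    and U :: "'c::real_normed_vector set"
  assumes "S homotopy_eqv T"
  shows "all_maps_null U S \<longleftrightarrow> all_maps_null U T"
  unfolding all_maps_null_def by (rule homotopy_eqv_homotopic_triviality_null [OF assms])

text \<open>Radial projection: the unit sphere is the relative frontier of the unit ball, which is
  homotopy equivalent to the affine hull minus an interior point, and that hull is the whole
  space.\<close>

lemma all_maps_null_punctured:
  "all_maps_null (S :: 'a::real_normed_vector set) (- {0 :: 'b::euclidean_space})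
   \<longleftrightarrow> all_maps_null S (sphere (0 :: 'b) 1)"
proof -
  have "affine hull cball (0 :: 'b) 1 = UNIV"
    by (metis aff_dim_cball aff_dim_lt_full not_less_iff_gr_or_eq zero_less_one)
  then have "sphere (0 :: 'b) 1 homotopy_eqv - {0 :: 'b}"
    using homotopy_eqv_rel_frontier_punctured_affine_hull [of "cball (0 :: 'b) 1" 0]
    by (simp add: Compl_eq_Diff_UNIV rel_interior_nonempty_interior)
  then show ?thesis
    using all_maps_null_codomain_cong by blast
qed

lemma continuous_on_Min_image:
  fixes f :: "'i \<Rightarrow> 'a::topological_space \<Rightarrow> real"
  assumes "finite I" "I \<noteq> {}" "\<And>i. i \<in> I \<Longrightarrow> continuous_on S (f i)"
  shows "continuous_on S (\<lambda>x. Min ((\<lambda>i. f i x) ` I))"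
  using assms
  by (induction I rule: finite_ne_induct) (simp_all add: continuous_on_min)

subsection \<open>Covers and maps to a punctured Euclidean space\<close>

text \<open>
  With \<open>v\<^sub>0, \<dots>, v\<^sub>m\<close> the standard basis vectors of \<open>\<real>\<^sup>m\<close> and minus their sum, every \<open>y\<close> is
  \<open>\<Sum>a\<^sub>i v\<^sub>i\<close> for a unique \<open>a \<ge> 0\<close> with smallest entry \<open>0\<close>. The map \<open>simplex_coord\<close> yields \<open>a\<close>,
  and \<open>simplex_point\<close> is \<open>a \<mapsto> \<Sum>a\<^sub>i v\<^sub>i\<close>; up to scaling they identify \<open>\<real>\<^sup>m - {0}\<close> with the
  boundary of an \<open>m\<close>-simplex. The bijection \<open>e\<close> numbers the coordinates of \<open>\<real>\<^sup>m\<close>.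
\<close>

definition simplex_point :: "('d \<Rightarrow> nat) \<Rightarrow> nat \<Rightarrow> (nat \<Rightarrow> real) \<Rightarrow> real ^ 'd" where
  "simplex_point e m a = (\<chi> j. a (e j) - a m)"

text \<open>For a numbering \<open>e\<close>, this is the preimage of \<open>y\<close> under
  \<open>simplex_point\<close> with entry m equal to 0. Adding a constant to all entries does not
  change \<open>simplex_point\<close>, so \<open>simplex_coord\<close> may shift the minimum to
  0.\<close>

definition simplex_lift :: "('d::finite \<Rightarrow> nat) \<Rightarrow> nat \<Rightarrow> real ^ 'd \<Rightarrow> nat \<Rightarrow> real" where
  "simplex_lift e m y i = (if i < m then y $ inv_into UNIV e i else 0)"

definition simplex_coord :: "('d::finite \<Rightarrow> nat) \<Rightarrow> nat \<Rightarrow> real ^ 'd \<Rightarrow> nat \<Rightarrow> real" where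
  "simplex_coord e m y i = simplex_lift e m y i - Min (simplex_lift e m y ` {..m})"

section \<open>Simplex coordinates and their inverse\<close>

lemma simplex_coord_nonneg: "i \<le> m \<Longrightarrow> 0 \<le> simplex_coord e m y i"
  unfolding simplex_coord_def by simp

lemma simplex_coord_ex_zero: "\<exists>i\<le>m. simplex_coord e m y i = 0"
proof -
  have "Min (simplex_lift e m y ` {..m}) \<in> simplex_lift e m y ` {..m}"
    by (rule Min_in) auto
  then obtain i where "i \<le> m" "Min (simplex_lift e m y ` {..m}) = simplex_lift e m y i"
    by blast
  then show ?thesis
    by (intro exI [of _ i]) (simp add: simplex_coord_def)
qed

lemma simplex_point_coord:
  assumes "bij_betw e UNIV {..<m}"
  shows "simplex_point e m (simplex_coord e m y) = y"
proof -
  have "inj e" "e j < m" for j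
    using assms by (auto simp: bij_betw_def)
  then show ?thesis
    by (simp add: simplex_point_def simplex_coord_def simplex_lift_def vec_eq_iff)
qed

lemma simplex_coord_ex_pos:
  assumes "bij_betw e UNIV {..<m}" "y \<noteq> 0"
  shows "\<exists>i\<le>m. 0 < simplex_coord e m y i"
proof (rule ccontr)
  assume "\<not> ?thesis"
  then have "simplex_coord e m y i = 0" if "i \<le> m" for i
    using simplex_coord_nonneg [OF that, of e y] that by (meson antisym_conv not_less)
  moreover have "e j < m" for j
    using assms by (auto simp: bij_betw_def)
  ultimately have "simplex_point e m (simplex_coord e m y) = 0"
    by (simp add: simplex_point_def vec_eq_iff less_imp_le)
  then show False
    using assms simplex_point_coord by metis
qed

text \<open>The lift of \<open>simplex_point e m a\<close> is \<open>a\<close> shifted by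
  \<open>- a m\<close>. As the smallest entry of \<open>a\<close> is 0, subtracting the minimum
  undoes the shift.\<close>

lemma simplex_coord_point:
  assumes e: "bij_betw e UNIV {..<m}"
    and a: "\<And>i. i \<le> m \<Longrightarrow> 0 \<le> a i" "\<exists>i\<le>m. a i = 0" and "i \<le> m"
  shows "simplex_coord e m (simplex_point e m a) i = a i"
proof -
  have lift: "simplex_lift e m (simplex_point e m a) i = a i - a m" if "i \<le> m" for i
    using that e
    by (auto simp: simplex_lift_def simplex_point_def bij_betw_def f_inv_into_f)
  obtain z where "z \<le> m" "a z = 0"
    using a by blast
  then have "Min (simplex_lift e m (simplex_point e m a) ` {..m}) = - a m"
    by (intro Min_eqI) (auto simp: lift a image_iff intro!: bexI [of _ z])
  then show ?thesis
    using lift [OF \<open>i \<le> m\<close>] by (simp add: simplex_coord_def)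
qed

text \<open>The kernel of \<open>simplex_point\<close> consists of the families that are constant on
  0, ..., m.\<close>

lemma simplex_point_nonzero:
  assumes e: "bij_betw e UNIV {..<m}" and "i \<le> m" "j \<le> m" "a i \<noteq> a j"
  shows "simplex_point e m a \<noteq> 0"
proof
  assume 0: "simplex_point e m a = 0"
  have const: "a l = a m" if l: "l \<le> m" for l
  proof (cases "l = m")
    case False
    then have "l \<in> range e"
      using e l by (simp add: bij_betw_def)
    then obtain d where "l = e d"
      by (rule rangeE)
    moreover have "simplex_point e m a $ d = 0"
      using 0 by simp
    ultimately show ?thesis
      by (simp add: simplex_point_def)
  qed simp
  show False
    using \<open>a i \<noteq> a j\<close> const [OF \<open>i \<le> m\<close>] const [OF \<open>j \<le> m\<close>] by simp
qed

lemma continuous_on_simplex_point: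
  assumes "bij_betw e UNIV {..<m}" "\<And>i. i \<le> m \<Longrightarrow> continuous_on S (\<lambda>x. a x i)"
  shows "continuous_on S (\<lambda>x. simplex_point e m (a x))"
proof -
  have "e j \<le> m" for j
    using bij_betwE [OF assms(1)] by (simp add: less_imp_le)
  then show ?thesis
    unfolding simplex_point_def by (intro continuous_intros assms(2)) auto
qed

lemma continuous_on_simplex_coord:
  assumes "continuous_on S f"
  shows "continuous_on S (\<lambda>x. simplex_coord e m (f x) i)"
proof -
  have "continuous_on S (\<lambda>x. simplex_lift e m (f x) i)" for i
    unfolding simplex_lift_def using assms by (cases "i < m") (auto intro!: continuous_intros)
  then show ?thesis
    unfolding simplex_coord_def by (intro continuous_intros continuous_on_Min_image) auto
qed

section \<open>Extension of nonnegative families and of covers to the ball\<close>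

lemma nonneg_family_extends:
  fixes a :: "nat \<Rightarrow> 'a::euclidean_space \<Rightarrow> real"
  assumes null: "all_maps_null (sphere 0 1 :: 'a set) (- {0 :: real ^ 'd})"
    and e: "bij_betw (e :: 'd::finite \<Rightarrow> nat) UNIV {..<m}"
    and cont: "\<And>i. i \<le> m \<Longrightarrow> continuous_on (sphere 0 1) (a i)"
    and nonneg: "\<And>i x. i \<le> m \<Longrightarrow> x \<in> sphere 0 1 \<Longrightarrow> 0 \<le> a i x"
    and zero: "\<And>x. x \<in> sphere 0 1 \<Longrightarrow> \<exists>i\<le>m. a i x = 0"
    and pos: "\<And>x. x \<in> sphere 0 1 \<Longrightarrow> \<exists>i\<le>m. 0 < a i x"
  obtains A :: "nat \<Rightarrow> 'a \<Rightarrow> real" where "\<And>i. continuous_on (cball 0 1) (A i)"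
    "\<And>i x. i \<le> m \<Longrightarrow> 0 \<le> A i x"
    "\<And>x. x \<in> cball 0 1 \<Longrightarrow> \<exists>i\<le>m. A i x = 0"
    "\<And>x. x \<in> cball 0 1 \<Longrightarrow> \<exists>i\<le>m. 0 < A i x"
    "\<And>i x. i \<le> m \<Longrightarrow> x \<in> sphere 0 1 \<Longrightarrow> A i x = a i x"
proof -
  \<comment> \<open>At each point of the sphere one entry is zero and one is positive, so
    \<open>?y\<close> avoids the origin.\<close>
  let ?y = "\<lambda>x. simplex_point e m (\<lambda>i. a i x)"
  have "continuous_on (sphere 0 1) ?y"
    using e cont by (rule continuous_on_simplex_point)
  moreover have "?y x \<noteq> 0" if "x \<in> sphere 0 1" for x
    using zero [OF that] pos [OF that] simplex_point_nonzero [OF e, where a = "\<lambda>i. a i x"]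
    by (metis less_irrefl)
  then have "?y \<in> sphere 0 1 \<rightarrow> - {0}"
    by blast
  ultimately have "\<exists>c. homotopic_with_canon (\<lambda>x. True) (sphere 0 1) (- {0}) ?y (\<lambda>x. c)"
    using null unfolding all_maps_null_def by blast
  \<comment> \<open>A map on the sphere is null-homotopic exactly when it extends to the ball within
    the same target. The simplex coordinates of the extension form the family sought.\<close>
  then obtain Y where Y: "continuous_on (cball 0 1) Y" "Y ` cball 0 1 \<subseteq> - {0}"
    "\<forall>x \<in> sphere 0 1. Y x = ?y x"
    unfolding nullhomotopic_from_sphere_extension by blast
  show thesis
  proof
    show "continuous_on (cball 0 1) (\<lambda>x. simplex_coord e m (Y x) i)" for i
      using Y(1) by (rule continuous_on_simplex_coord)
    show "\<exists>i\<le>m. 0 < simplex_coord e m (Y x) i" if "x \<in> cball 0 1" for x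
      using Y(2) that by (intro simplex_coord_ex_pos [OF e]) auto
    show "simplex_coord e m (Y x) i = a i x" if "i \<le> m" "x \<in> sphere 0 1" for i x
      using simplex_coord_point [OF e, of "\<lambda>i. a i x" i] nonneg zero that Y(3) by simp
    show "0 \<le> simplex_coord e m (Y x) i" if "i \<le> m" for i x
      using that by (rule simplex_coord_nonneg)
    show "\<exists>i\<le>m. simplex_coord e m (Y x) i = 0" for x
      by (rule simplex_coord_ex_zero)
  qed
qed

lemma closedin_zero_function:
  fixes X :: "'a::metric_space set"
  assumes "closedin (top_of_set X) T"
  shows "\<exists>a::'a \<Rightarrow> real. continuous_on X a \<and> (\<forall>x. 0 \<le> a x) \<and> (\<forall>x\<in>X. a x = 0 \<longleftrightarrow> x \<in> T)"
proof (cases "T = {}")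
  case True
  \<comment> \<open>The distance to the empty set is 0 by convention and would vanish everywhere, so
    the constant 1 replaces it.\<close>
  then show ?thesis
    by (intro exI [of _ "\<lambda>_. 1"]) auto
next
  case False
  obtain C where C: "closed C" "T = X \<inter> C"
    using assms by (auto simp: closedin_closed)
  \<comment> \<open>The closure of \<open>T\<close> adds no points of \<open>X\<close>, so on
    \<open>X\<close> the distance to \<open>T\<close> vanishes exactly on \<open>T\<close>.\<close>
  then have "closure T \<subseteq> C"
    by (intro closure_minimal) auto
  then have "X \<inter> closure T = T"
    using C closure_subset [of T] by blast
  then have "\<forall>x\<in>X. infdist x T = 0 \<longleftrightarrow> x \<in> T"
    using in_closure_iff_infdist_zero [OF False] by blast
  then show ?thesis
    by (intro exI [of _ "\<lambda>x. infdist x T"] conjI continuous_intros) (auto intro: infdist_nonneg)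
qed

lemma closedin_zero_functions:
  fixes X :: "'a::metric_space set"
  assumes "\<And>i. i \<le> (m::nat) \<Longrightarrow> closedin (top_of_set X) (T i)"
  obtains a :: "nat \<Rightarrow> 'a \<Rightarrow> real" where "\<And>i. i \<le> m \<Longrightarrow> continuous_on X (a i)"
    "\<And>i x. i \<le> m \<Longrightarrow> 0 \<le> a i x" "\<And>i x. i \<le> m \<Longrightarrow> x \<in> X \<Longrightarrow> a i x = 0 \<longleftrightarrow> x \<in> T i"
proof -
  define P where "P i a \<longleftrightarrow> continuous_on X a \<and> (\<forall>x. 0 \<le> a x) \<and> (\<forall>x\<in>X. a x = 0 \<longleftrightarrow> x \<in> T i)"
    for i and a :: "'a \<Rightarrow> real"
  have "\<exists>a. P i a" if "i \<le> m" for i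
    unfolding P_def by (rule closedin_zero_function [OF assms [OF that]])
  then obtain a where a: "\<And>i. i \<le> m \<Longrightarrow> P i (a i)"
    by metis
  show ?thesis
  proof (rule that [of a])
    show "continuous_on X (a i)" if "i \<le> m" for i
      using a [OF that] by (simp add: P_def)
    show "0 \<le> a i x" if "i \<le> m" for i x
      using a [OF that] by (simp add: P_def)
    show "a i x = 0 \<longleftrightarrow> x \<in> T i" if "i \<le> m" "x \<in> X" for i x
      using a [OF that(1)] that(2) by (simp add: P_def)
  qed
qed

text \<open>Take functions \<open>a i\<close> vanishing exactly on \<open>S i\<close>. Covering
  means that some entry is zero at each point, empty intersection that some entry is positive. Both
  properties survive in the extended family, whose zero sets form \<open>F\<close>.\<close>

lemma closed_cover_extends:
  fixes S :: "nat \<Rightarrow> 'a::euclidean_space set"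
  assumes null: "all_maps_null (sphere 0 1 :: 'a set) (- {0 :: real ^ 'd})"
    and e: "bij_betw (e :: 'd::finite \<Rightarrow> nat) UNIV {..<m}"
    and S: "closed_cover m (sphere 0 1) S" "(\<Inter>i\<le>m. S i) = {}"
  obtains F where "closed_cover m (cball 0 1) F" "(\<Inter>i\<le>m. F i) = {}"
    "\<forall>i\<le>m. S i = F i \<inter> sphere 0 1"
proof -
  have Scl: "\<And>i. i \<le> m \<Longrightarrow> closedin (top_of_set (sphere 0 1)) (S i)"
    and Sun: "(\<Union>i\<le>m. S i) = sphere 0 1"
    using S(1) by (auto simp: closed_cover_def)
  then have Ssub: "S i \<subseteq> sphere 0 1" if "i \<le> m" for i
    using that by blast
  obtain a :: "nat \<Rightarrow> 'a \<Rightarrow> real" where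
    a: "\<And>i. i \<le> m \<Longrightarrow> continuous_on (sphere 0 1) (a i)" "\<And>i x. i \<le> m \<Longrightarrow> 0 \<le> a i x"
    "\<And>i x. i \<le> m \<Longrightarrow> x \<in> sphere 0 1 \<Longrightarrow> a i x = 0 \<longleftrightarrow> x \<in> S i"
    by (rule closedin_zero_functions [of m "sphere 0 1" S]) (use Scl that in blast)+
  have zero: "\<exists>i\<le>m. a i x = 0" if "x \<in> sphere 0 1" for x
    using that Sun a(3) by (metis UN_E atMost_iff)
  have pos: "\<exists>i\<le>m. 0 < a i x" if "x \<in> sphere 0 1" for x
  proof -
    obtain i where "i \<le> m" "x \<notin> S i"
      using S(2) by blast
    then show ?thesis
      using a(2,3) that by (metis order_le_less)
  qed
  obtain A :: "nat \<Rightarrow> 'a \<Rightarrow> real" where A: "\<And>i. continuous_on (cball 0 1) (A i)"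
    "\<And>i x. i \<le> m \<Longrightarrow> 0 \<le> A i x"
    "\<And>x. x \<in> cball 0 1 \<Longrightarrow> \<exists>i\<le>m. A i x = 0"
    "\<And>x. x \<in> cball 0 1 \<Longrightarrow> \<exists>i\<le>m. 0 < A i x"
    "\<And>i x. i \<le> m \<Longrightarrow> x \<in> sphere 0 1 \<Longrightarrow> A i x = a i x"
    by (rule nonneg_family_extends [OF null e, of a]) (use a zero pos that in blast)+
  let ?F = "\<lambda>i. {x \<in> cball 0 1. A i x = 0}"
  show thesis
  proof
    show "closed_cover m (cball 0 1) ?F"
      unfolding closed_cover_def
    proof (intro conjI allI impI)
      show "closedin (top_of_set (cball 0 1)) (?F i)" for i
        by (intro continuous_closedin_preimage_constant A(1))
      show "(\<Union>i\<le>m. ?F i) = cball 0 1"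
        using A(3) by fastforce
    qed
    show "(\<Inter>i\<le>m. ?F i) = {}"
      using A(4) by (fastforce simp: less_le)
    show "\<forall>i\<le>m. S i = ?F i \<inter> sphere 0 1"
    proof (intro allI impI)
      fix i
      assume "i \<le> m"
      then show "S i = ?F i \<inter> sphere 0 1"
        using Ssub [of i] a(3) [of i] A(5) [of i] by auto
    qed
  qed
qed

text \<open>Here \<open>a i\<close> vanishes exactly off \<open>S i\<close>, so the two conditions
  trade places: covering gives a positive entry, empty intersection a zero one. The positivity sets
  of the extended family form \<open>F\<close>.\<close>

lemma open_cover_extends:
  fixes S :: "nat \<Rightarrow> 'a::euclidean_space set"
  assumes null: "all_maps_null (sphere 0 1 :: 'a set) (- {0 :: real ^ 'd})"
    and e: "bij_betw (e :: 'd::finite \<Rightarrow> nat) UNIV {..<m}"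
    and S: "open_cover m (sphere 0 1) S" "(\<Inter>i\<le>m. S i) = {}"
  obtains F where "open_cover m (cball 0 1) F" "(\<Inter>i\<le>m. F i) = {}"
    "\<forall>i\<le>m. S i = F i \<inter> sphere 0 1"
proof -
  have Sop: "\<And>i. i \<le> m \<Longrightarrow> closedin (top_of_set (sphere 0 1)) (sphere 0 1 - S i)"
    and Sun: "(\<Union>i\<le>m. S i) = sphere 0 1"
    using S(1) by (auto simp: open_cover_def)
  then have Ssub: "S i \<subseteq> sphere 0 1" if "i \<le> m" for i
    using that by blast
  obtain a :: "nat \<Rightarrow> 'a \<Rightarrow> real" where
    a: "\<And>i. i \<le> m \<Longrightarrow> continuous_on (sphere 0 1) (a i)" "\<And>i x. i \<le> m \<Longrightarrow> 0 \<le> a i x"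
    "\<And>i x. i \<le> m \<Longrightarrow> x \<in> sphere 0 1 \<Longrightarrow> a i x = 0 \<longleftrightarrow> x \<in> sphere 0 1 - S i"
    by (rule closedin_zero_functions [of m "sphere 0 1" "\<lambda>i. sphere 0 1 - S i"]) (use Sop that in blast)+
  have zero: "\<exists>i\<le>m. a i x = 0" if "x \<in> sphere 0 1" for x
  proof -
    obtain i where "i \<le> m" "x \<notin> S i"
      using S(2) by blast
    then show ?thesis
      using a(3) that by blast
  qed
  have pos: "\<exists>i\<le>m. 0 < a i x" if "x \<in> sphere 0 1" for x
  proof -
    obtain i where "i \<le> m" "x \<in> S i"
      using Sun \<open>x \<in> sphere 0 1\<close> by blast
    then show ?thesis
      using a(2,3) that by (metis DiffE order_le_less)
  qed
  obtain A :: "nat \<Rightarrow> 'a \<Rightarrow> real" where A: "\<And>i. continuous_on (cball 0 1) (A i)"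
    "\<And>i x. i \<le> m \<Longrightarrow> 0 \<le> A i x"
    "\<And>x. x \<in> cball 0 1 \<Longrightarrow> \<exists>i\<le>m. A i x = 0"
    "\<And>x. x \<in> cball 0 1 \<Longrightarrow> \<exists>i\<le>m. 0 < A i x"
    "\<And>i x. i \<le> m \<Longrightarrow> x \<in> sphere 0 1 \<Longrightarrow> A i x = a i x"
    by (rule nonneg_family_extends [OF null e, of a]) (use a zero pos that in blast)+
  let ?F = "\<lambda>i. {x \<in> cball 0 1. 0 < A i x}"
  show thesis
  proof
    show "open_cover m (cball 0 1) ?F"
      unfolding open_cover_def
    proof (intro conjI allI impI)
      have "?F i = cball 0 1 \<inter> A i -` {0<..}" for i
        by auto
      then show "openin (top_of_set (cball 0 1)) (?F i)" for i
        by (simp only:) (intro continuous_openin_preimage_gen A(1) open_greaterThan)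
      show "(\<Union>i\<le>m. ?F i) = cball 0 1"
        using A(4) by fastforce
    qed
    show "(\<Inter>i\<le>m. ?F i) = {}"
      using A(3) by (fastforce simp: less_le)
    show "\<forall>i\<le>m. S i = ?F i \<inter> sphere 0 1"
    proof (intro allI impI)
      fix i
      assume "i \<le> m"
      then show "S i = ?F i \<inter> sphere 0 1"
        using Ssub [of i] a(2,3) [of i] A(5) [of i] by (auto simp: less_le)
    qed
  qed
qed

text \<open>Covers that are open and closed at once are treated apart, since the two constructions
  above each control only one of these properties. The bound on the dimension makes the sphere
  connected.\<close>

lemma cover_extends_disjointly:
  fixes S :: "nat \<Rightarrow> 'a::euclidean_space set"
  assumes null: "all_maps_null (sphere 0 1 :: 'a set) (- {0 :: real ^ 'd})"
    and e: "bij_betw (e :: 'd::finite \<Rightarrow> nat) UNIV {..<m}"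
    and dim: "2 \<le> DIM('a)"
    and S: "cover m (sphere 0 1) S" "(\<Inter>i\<le>m. S i) = {}"
  obtains F where "cover_extends m (cball 0 1) F (sphere 0 1) S" "(\<Inter>i\<le>m. F i) = {}"
proof -
  consider "open_cover m (sphere 0 1) S" "closed_cover m (sphere 0 1) S"
    | "open_cover m (sphere 0 1) S" "\<not> closed_cover m (sphere 0 1) S"
    | "closed_cover m (sphere 0 1) S" "\<not> open_cover m (sphere 0 1) S"
    using S(1) by (auto simp: cover_def)
  then show thesis
  proof cases
    \<comment> \<open>An extension has to be open and closed here, but all members are trivial.\<close>
    case 1
    have ne: "sphere (0 :: 'a) 1 \<noteq> {}"
      by simp
    have "connected (sphere (0 :: 'a) 1)"
      using dim by (rule connected_sphere)
    then have triv: "S i = {} \<or> S i = sphere 0 1" if "i \<le> m" for i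
      using 1 that by (auto simp: connected_clopen open_cover_def closed_cover_def)
    have Sun: "(\<Union>i\<le>m. S i) = sphere 0 1"
      using 1 by (auto simp: open_cover_def)
    let ?F = "\<lambda>i. if S i = {} then {} else cball (0 :: 'a) 1"
    have "\<exists>i\<le>m. S i = {}"
    proof (rule ccontr)
      assume "\<not> ?thesis"
      then have "\<forall>i\<le>m. S i = sphere 0 1"
        using triv by blast
      then have "(\<Inter>i\<le>m. S i) = sphere 0 1"
        by auto
      then show False
        using S(2) ne by metis
    qed
    then obtain n where n: "n \<le> m" "S n = {}"
      by blast
    then have "(\<Inter>i\<le>m. ?F i) \<subseteq> ?F n"
      by (intro INT_lower) simp
    then have F0: "(\<Inter>i\<le>m. ?F i) = {}"
      using n by simp
    obtain l where "l \<le> m" "S l \<noteq> {}"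
      using Sun ne by blast
    then have "(\<Union>i\<le>m. ?F i) = cball 0 1"
      by (intro equalityI UN_least subset_trans [OF _ UN_upper [of l]]) auto
    then have "open_cover m (cball 0 1) ?F" "closed_cover m (cball 0 1) ?F"
      by (auto simp: open_cover_def closed_cover_def)
    moreover have "S i = ?F i \<inter> sphere 0 1" if "i \<le> m" for i
      using triv [OF that] by auto
    ultimately show ?thesis
      using S(1) F0 by (intro that [of ?F]) (simp_all add: cover_extends_def cover_def sphere_cball)
  next
    case 2
    obtain F where "open_cover m (cball 0 1) F" "(\<Inter>i\<le>m. F i) = {}"
      "\<forall>i\<le>m. S i = F i \<inter> sphere 0 1"
      by (rule open_cover_extends [OF null e 2(1) S(2)], rule that)
    then show ?thesis
      using 2 S(1) by (intro that [of F]) (simp_all add: cover_extends_def cover_def sphere_cball)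
  next
    case 3
    obtain F where "closed_cover m (cball 0 1) F" "(\<Inter>i\<le>m. F i) = {}"
      "\<forall>i\<le>m. S i = F i \<inter> sphere 0 1"
      by (rule closed_cover_extends [OF null e 3(1) S(2)], rule that)
    then show ?thesis
      using 3 S(1) by (intro that [of F]) (simp_all add: cover_extends_def cover_def sphere_cball)
  qed
qed

text \<open>\<open>S\<close> consists of the zero sets of the simplex coordinates of
  \<open>y\<close>. A closed extension \<open>F\<close> with empty intersection yields, through
  functions vanishing exactly on its members, a map \<open>?Y\<close> from the ball to the punctured
  space. On the sphere \<open>?Y\<close> is null-homotopic and homotopic to \<open>y\<close>, a
  contradiction.\<close>

lemma non_null_map_gives_cover:
  fixes y :: "'a::euclidean_space \<Rightarrow> real ^ 'd"
  assumes e: "bij_betw (e :: 'd::finite \<Rightarrow> nat) UNIV {..<m}"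
    and y: "continuous_on (sphere 0 1) y" "y \<in> sphere 0 1 \<rightarrow> - {0}"
    and essential: "\<nexists>c. homotopic_with_canon (\<lambda>x. True) (sphere 0 1) (- {0}) y (\<lambda>x. c)"
  obtains S :: "nat \<Rightarrow> 'a set" where "cover m (sphere 0 1) S" "(\<Inter>i\<le>m. S i) = {}"
    "\<And>F. cover_extends m (cball 0 1) F (sphere 0 1) S \<Longrightarrow> (\<Inter>i\<le>m. F i) \<noteq> {}"
proof -
  let ?S = "\<lambda>i. {x \<in> sphere 0 1. simplex_coord e m (y x) i = 0}"
  have S: "closed_cover m (sphere 0 1) ?S"
    unfolding closed_cover_def
  proof (intro conjI allI impI)
    show "closedin (top_of_set (sphere 0 1)) (?S i)" for i
      by (intro continuous_closedin_preimage_constant continuous_on_simplex_coord y(1))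
    show "(\<Union>i\<le>m. ?S i) = sphere 0 1"
      using simplex_coord_ex_zero [of m e] by fastforce
  qed
  have "\<exists>i\<le>m. 0 < simplex_coord e m (y x) i" if "x \<in> sphere 0 1" for x
    using y(2) that by (intro simplex_coord_ex_pos [OF e]) auto
  then have disj: "(\<Inter>i\<le>m. ?S i) = {}"
    by (fastforce simp: less_le)
  have "(\<Inter>i\<le>m. F i) \<noteq> {}" if "cover_extends m (cball 0 1) F (sphere 0 1) ?S" for F
  proof
    assume empty: "(\<Inter>i\<le>m. F i) = {}"
    have F: "closed_cover m (cball 0 1) F" and FS: "\<And>i. i \<le> m \<Longrightarrow> ?S i = F i \<inter> sphere 0 1"
      using that S unfolding cover_extends_def by auto
    have Fcl: "\<And>i. i \<le> m \<Longrightarrow> closedin (top_of_set (cball 0 1)) (F i)"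
      and Fun: "(\<Union>i\<le>m. F i) = cball 0 1"
      using F by (auto simp: closed_cover_def)
    obtain A :: "nat \<Rightarrow> 'a \<Rightarrow> real" where
      A: "\<And>i. i \<le> m \<Longrightarrow> continuous_on (cball 0 1) (A i)" "\<And>i x. i \<le> m \<Longrightarrow> 0 \<le> A i x"
      "\<And>i x. i \<le> m \<Longrightarrow> x \<in> cball 0 1 \<Longrightarrow> A i x = 0 \<longleftrightarrow> x \<in> F i"
      by (rule closedin_zero_functions [of m "cball 0 1" F]) (use Fcl that in blast)+
    let ?Y = "\<lambda>x. simplex_point e m (\<lambda>i. A i x)"
    have Ycont: "continuous_on (cball 0 1) ?Y"
      using e A(1) by (rule continuous_on_simplex_point)
    have Ynz: "?Y x \<noteq> 0" if x: "x \<in> cball 0 1" for x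
    proof -
      obtain i where "i \<le> m" "x \<in> F i"
        using Fun x by blast
      moreover obtain j where "j \<le> m" "x \<notin> F j"
        using empty by blast
      ultimately have "A i x = 0" "A j x \<noteq> 0"
        using A(3) [of i x] A(3) [of j x] x by auto
      then show ?thesis
        using simplex_point_nonzero [OF e \<open>i \<le> m\<close> \<open>j \<le> m\<close>, of "\<lambda>i. A i x"] by simp
    qed
    \<comment> \<open>On the sphere \<open>?Y\<close> is null-homotopic because it is defined on the
      whole ball.\<close>
    have "\<exists>c. homotopic_with_canon (\<lambda>x. True) (sphere 0 1) (- {0}) ?Y (\<lambda>x. c)"
      unfolding nullhomotopic_from_sphere_extension
      using Ycont Ynz by (intro exI [of _ ?Y]) auto
    then obtain c where c: "homotopic_with_canon (\<lambda>x. True) (sphere 0 1) (- {0}) ?Y (\<lambda>x. c)"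
      by blast
    \<comment> \<open>The coordinates of \<open>y\<close> and \<open>A\<close> have the same zero sets, so no convex combination of the two
      families has all its entries equal.\<close>
    have "homotopic_with_canon (\<lambda>x. True) (sphere 0 1) (- {0}) y ?Y"
    proof (rule homotopic_with_linear [OF y(1)])
      show "continuous_on (sphere 0 1) ?Y"
        using Ycont sphere_cball by (rule continuous_on_subset)
      fix x :: 'a
      assume x: "x \<in> sphere 0 1"
      then have xb: "x \<in> cball 0 1"
        by simp
      have "(1 - u) *\<^sub>R y x + u *\<^sub>R ?Y x \<noteq> 0" if u: "0 \<le> u" "u \<le> 1" for u
      proof -
        \<comment> \<open>As \<open>simplex_point\<close> is linear, the point of the segment comes
          from this convex combination of the two families.\<close>
        let ?w = "\<lambda>i. (1 - u) * simplex_coord e m (y x) i + u * A i x"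
        have "(1 - u) *\<^sub>R y x + u *\<^sub>R ?Y x
            = (1 - u) *\<^sub>R simplex_point e m (simplex_coord e m (y x)) + u *\<^sub>R ?Y x"
          by (simp only: simplex_point_coord [OF e])
        also have "\<dots> = simplex_point e m ?w"
          by (simp add: simplex_point_def vec_eq_iff algebra_simps)
        finally have eq: "(1 - u) *\<^sub>R y x + u *\<^sub>R ?Y x = simplex_point e m ?w" .
        obtain i where i: "i \<le> m" "x \<in> F i"
          using Fun xb by blast
        obtain j where j: "j \<le> m" "x \<notin> F j"
          using empty by blast
        have "x \<in> ?S i" "x \<notin> ?S j"
          using FS [OF i(1)] FS [OF j(1)] i(2) j(2) x by blast+
        then have coord: "simplex_coord e m (y x) i = 0" "simplex_coord e m (y x) j \<noteq> 0"
          using x by auto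
        have "A i x = 0"
          using i(2) A(3) [OF i(1) xb] by simp
        with coord(1) have "?w i = 0"
          by simp
        moreover have "0 < simplex_coord e m (y x) j"
          using coord(2) simplex_coord_nonneg [OF j(1), of e "y x"] by simp
        moreover have "0 < A j x"
          using A(2) [OF j(1), of x] A(3) [OF j(1) xb] j(2) by simp
        ultimately have "?w i \<noteq> ?w j"
          using u by (smt (verit) mult_nonneg_nonneg mult_pos_pos)
        then show ?thesis
          unfolding eq by (rule simplex_point_nonzero [OF e i(1) j(1)])
      qed
      then show "closed_segment (y x) (?Y x) \<subseteq> - {0}"
        by (auto simp: in_segment)
    qed
    then show False
      using essential homotopic_with_trans [OF _ c] by blast
  qed
  then show thesis
    using S disj by (intro that [of ?S]) (auto simp: cover_def)
qed

theorem covers_iff_not_all_maps_null: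
  assumes "bij_betw (e :: 'd::finite \<Rightarrow> nat) UNIV {..<m}" "2 \<le> DIM('a::euclidean_space)"
  shows "(\<exists>S. cover m (sphere (0 :: 'a) 1) S \<and> (\<Inter>i\<le>m. S i) = {} \<and>
            (\<forall>F. cover m (cball 0 1) F \<and>
                 cover_extends m (cball 0 1) F (sphere 0 1) S \<longrightarrow> (\<Inter>i\<le>m. F i) \<noteq> {}))
    \<longleftrightarrow> \<not> all_maps_null (sphere (0 :: 'a) 1) (- {0 :: real ^ 'd})"
    (is "?L \<longleftrightarrow> ?R")
proof
  assume ?L
  then obtain S where "cover m (sphere (0 :: 'a) 1) S \<and> (\<Inter>i\<le>m. S i) = {} \<and>
      (\<forall>F. cover m (cball 0 1) F \<and> cover_extends m (cball 0 1) F (sphere 0 1) S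
        \<longrightarrow> (\<Inter>i\<le>m. F i) \<noteq> {})"
    by (rule exE)
  note S = this [THEN conjunct1] this [THEN conjunct2, THEN conjunct1]
    and F = this [THEN conjunct2, THEN conjunct2]
  show ?R
  proof
    assume null: "all_maps_null (sphere (0 :: 'a) 1) (- {0 :: real ^ 'd})"
    obtain F where "cover_extends m (cball 0 1) F (sphere 0 1) S" "(\<Inter>i\<le>m. F i) = {}"
      by (rule cover_extends_disjointly [OF null assms S], rule that)
    then show False
      using F [rule_format, of F] by (simp add: cover_extends_def)
  qed
next
  assume ?R
  then obtain y :: "'a \<Rightarrow> real ^ 'd" where "(continuous_on (sphere 0 1) y \<and> y \<in> sphere 0 1 \<rightarrow> - {0}) \<and>
      \<not> (\<exists>c. homotopic_with_canon (\<lambda>x. True) (sphere 0 1) (- {0}) y (\<lambda>x. c))"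
    unfolding all_maps_null_def not_all not_imp by (rule exE)
  note y = this [THEN conjunct1, THEN conjunct1] this [THEN conjunct1, THEN conjunct2]
    this [THEN conjunct2]
  show ?L
  proof (rule non_null_map_gives_cover [OF assms(1) y])
    fix S :: "nat \<Rightarrow> 'a set"
    assume S: "cover m (sphere 0 1) S" "(\<Inter>i\<le>m. S i) = {}"
      and F: "\<And>F. cover_extends m (cball 0 1) F (sphere 0 1) S \<Longrightarrow> (\<Inter>i\<le>m. F i) \<noteq> {}"
    show ?L
      by (rule exI [of _ S], intro conjI S allI impI, elim conjE, rule F)
  qed
qed

subsection \<open>Spheroids and maps of spheres\<close>

lemma frontier_unit_cbox_cart:
  "frontier (cbox 0 1 :: (real ^ 'n) set) = {z \<in> cbox 0 1. \<exists>j. z $ j = 0 \<or> z $ j = 1}"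
proof -
  have "box 0 1 = {z \<in> cbox (0 :: real ^ 'n) 1. \<not> (\<exists>j. z $ j = 0 \<or> z $ j = 1)}"
    by (auto simp: mem_box_cart less_le)
  then show ?thesis
    unfolding frontier_cbox by blast
qed

text \<open>The centre is an interior point, so the cube is full-dimensional. This makes results on
  relative frontiers of convex sets applicable to its boundary.\<close>

lemma rel_frontier_unit_cbox_cart:
  "rel_frontier (cbox 0 1 :: (real ^ 'n) set) = frontier (cbox 0 1)"
  "aff_dim (cbox 0 1 :: (real ^ 'n) set) = int CARD('n)"
proof -
  have "(\<chi> j. 1/2) \<in> box (0 :: real ^ 'n) 1"
    by (simp add: mem_box_cart)
  then have "interior (cbox (0 :: real ^ 'n) 1) \<noteq> {}"
    by (auto simp: interior_cbox)
  then have ad: "aff_dim (cbox (0 :: real ^ 'n) 1) = DIM(real ^ 'n)"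
    by (rule aff_dim_nonempty_interior)
  then show "aff_dim (cbox 0 1 :: (real ^ 'n) set) = int CARD('n)"
    by simp
  have "affine hull (cbox (0 :: real ^ 'n) 1) = UNIV"
    using ad by (simp only: aff_dim_eq_full)
  then show "rel_frontier (cbox 0 1 :: (real ^ 'n) set) = frontier (cbox 0 1)"
    by (rule rel_frontier_frontier)
qed

text \<open>As in stereographic projection, the boundary of a convex body minus a point is
  homeomorphic to a hyperplane, which is convex.\<close>

lemma contractible_punctured_cube_frontier:
  fixes p :: "real ^ 'n"
  assumes "p \<in> frontier (cbox 0 1)"
  shows "contractible (frontier (cbox 0 1) - {p})"
proof -
  obtain U :: "(real ^ 'n) set" where U: "affine U" "aff_dim U = int CARD('n) - 1"
    using choose_affine_subset [OF affine_UNIV, of "int CARD('n) - 1", where 'a = "real ^ 'n"] by auto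
  have "rel_frontier (cbox 0 1) - {p} homeomorphic U"
    using assms U
    by (intro homeomorphic_punctured_sphere_affine_gen)
      (auto simp: rel_frontier_unit_cbox_cart)
  then show ?thesis
    using U(1) homeomorphic_contractible_eq [of "rel_frontier (cbox 0 1) - {p}" U]
    by (simp add: rel_frontier_unit_cbox_cart affine_imp_convex convex_imp_contractible)
qed

text \<open>Both are relative frontiers of bounded convex sets of the same dimension.\<close>

lemma sphere_homeomorphic_cube_frontier:
  "sphere (0 :: real ^ 'n) 1 homeomorphic frontier (cbox 0 1 :: (real ^ 'n) set)"
proof -
  have "rel_frontier (cball (0 :: real ^ 'n) 1) homeomorphic rel_frontier (cbox (0 :: real ^ 'n) 1)"
    by (intro homeomorphic_rel_frontiers_convex_bounded_sets)
      (auto simp: rel_frontier_unit_cbox_cart aff_dim_cball)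
  then show ?thesis
    by (simp add: rel_frontier_unit_cbox_cart)
qed

text \<open>Homotopy relative to the boundary is an equivalence relation, so a spheroid has the
  class of the constant one exactly when it is homotopic to it.\<close>

lemma spheroids_trivial_iff:
  assumes "x0 \<in> topspace X"
  shows "carrier (homotopy_group k X x0) = {\<one>\<^bsub>homotopy_group k X x0\<^esub>} \<longleftrightarrow>
    (\<forall>f\<in>spheroids k X x0.
      homotopic_with (\<lambda>h. \<forall>t\<in>cube_boundary k. h t = x0) (unit_cube k) X f (\<lambda>_. x0))"
proof -
  let ?hom = "homotopic_with (\<lambda>h. \<forall>t\<in>cube_boundary k. h t = x0) (unit_cube k) X"
  have const: "(\<lambda>_. x0) \<in> spheroids k X x0"
    using assms by (simp add: spheroids_def)
  have "spheroid_class k X x0 f = spheroid_class k X x0 (\<lambda>_. x0) \<longleftrightarrow> ?hom f (\<lambda>_. x0)"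
    if f: "f \<in> spheroids k X x0" for f
  proof
    have "?hom (\<lambda>_. x0) (\<lambda>_. x0)"
      using assms by simp
    moreover assume "spheroid_class k X x0 f = spheroid_class k X x0 (\<lambda>_. x0)"
    ultimately show "?hom f (\<lambda>_. x0)"
      unfolding spheroid_class_def by blast
  next
    assume "?hom f (\<lambda>_. x0)"
    then show "spheroid_class k X x0 f = spheroid_class k X x0 (\<lambda>_. x0)"
      unfolding spheroid_class_def
      using homotopic_with_symD homotopic_with_trans by blast
  qed
  then have "(\<forall>f\<in>spheroids k X x0. ?hom f (\<lambda>_. x0)) \<longleftrightarrow>
      spheroid_class k X x0 ` spheroids k X x0 \<subseteq> {spheroid_class k X x0 (\<lambda>_. x0)}"
    by auto
  then show ?thesis
    using const by (auto simp: homotopy_group_def)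
qed

text \<open>The general description of \<open>homotopic_with\<close> asks for a property that
  depends only on values on the space. The boundary condition is one, since the boundary lies in the
  cube.\<close>

lemma homotopic_rel_cube_boundary:
  "homotopic_with (\<lambda>h. \<forall>t\<in>cube_boundary k. h t = x0) (unit_cube k) X f g \<longleftrightarrow>
    (\<exists>h. continuous_map (prod_topology (top_of_set {0..1::real}) (unit_cube k)) X h \<and>
         (\<forall>t\<in>topspace (unit_cube k). h (0, t) = f t) \<and>
         (\<forall>t\<in>topspace (unit_cube k). h (1, t) = g t) \<and>
         (\<forall>s\<in>{0..1}. \<forall>t\<in>cube_boundary k. h (s, t) = x0))"
proof (rule homotopic_with [where P = "\<lambda>h. \<forall>t\<in>cube_boundary k. h t = x0"])
  fix h k' :: "(nat \<Rightarrow> real) \<Rightarrow> 'a"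
  assume "\<And>t. t \<in> topspace (unit_cube k) \<Longrightarrow> h t = k' t"
  then have "h t = k' t" if "t \<in> cube_boundary k" for t
    using that by (simp add: cube_boundary_def)
  then show "(\<forall>t\<in>cube_boundary k. h t = x0) \<longleftrightarrow> (\<forall>t\<in>cube_boundary k. k' t = x0)"
    by simp
qed

text \<open>
  \<open>cube_join\<close> identifies \<open>[0,1] \<times> [0,1]\<^sup>k\<close> with a cube of dimension \<open>k + 1\<close>; the bijection \<open>e\<close>
  numbers the coordinates of the latter, and number \<open>k\<close> is the homotopy parameter.
\<close>

definition cube_join :: "('n \<Rightarrow> nat) \<Rightarrow> nat \<Rightarrow> real \<times> (nat \<Rightarrow> real) \<Rightarrow> real ^ 'n" where
  "cube_join e k = (\<lambda>(s, t). \<chi> j. if e j = k then s else t (e j))"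

text \<open>Inverse of \<open>cube_join\<close>. The restriction makes the second component
  extensional, as points of \<open>unit_cube\<close> are.\<close>

definition cube_split :: "('n::finite \<Rightarrow> nat) \<Rightarrow> nat \<Rightarrow> real ^ 'n \<Rightarrow> real \<times> (nat \<Rightarrow> real)" where
  "cube_split e k z = (z $ inv_into UNIV e k, restrict (\<lambda>i. z $ inv_into UNIV e i) {..<k})"

section \<open>The cube of dimension k + 1 as a product\<close>

lemma topspace_unit_cube: "topspace (unit_cube k) = (\<Pi>\<^sub>E i\<in>{..<k}. {0..1})"
  by (simp add: unit_cube_def)

lemma unit_cube_component:
  assumes "t \<in> topspace (unit_cube k)" "i < k"
  shows "0 \<le> t i" "t i \<le> 1"
  using assms by (auto simp: topspace_unit_cube PiE_iff)

context
  fixes e :: "'n::finite \<Rightarrow> nat" and k :: nat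
  assumes e: "bij_betw e UNIV {..k}"
begin

lemma e_le: "e j \<le> k"
  using bij_betwE [OF e] by simp

lemma inv_e: "inv_into UNIV e (e j) = j"
  using bij_betw_inv_into_left [OF e] by simp

lemma e_inv: "i \<le> k \<Longrightarrow> e (inv_into UNIV e i) = i"
  using bij_betw_inv_into_right [OF e] by simp

lemma cube_split_join:
  assumes "t \<in> topspace (unit_cube k)"
  shows "cube_split e k (cube_join e k (s, t)) = (s, t)"
proof -
  have "restrict (\<lambda>i. t i) {..<k} = t"
    using assms by (auto simp: topspace_unit_cube PiE_iff extensional_restrict)
  moreover have "restrict (\<lambda>i. cube_join e k (s, t) $ inv_into UNIV e i) {..<k} = restrict (\<lambda>i. t i) {..<k}"
    by (rule restrict_ext) (simp add: cube_join_def e_inv)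
  ultimately show ?thesis
    by (simp add: cube_split_def) (simp add: cube_join_def e_inv)
qed

lemma cube_join_split: "cube_join e k (cube_split e k z) = z"
proof -
  have "cube_join e k (cube_split e k z) $ j = z $ j" for j
    using e_le [of j] inv_e [of j] by (auto simp: cube_join_def cube_split_def)
  then show ?thesis
    by (simp add: vec_eq_iff)
qed

lemma cube_join_in_cbox:
  assumes "s \<in> {0..1}" "t \<in> topspace (unit_cube k)"
  shows "cube_join e k (s, t) \<in> cbox 0 1"
proof -
  have "0 \<le> cube_join e k (s, t) $ j \<and> cube_join e k (s, t) $ j \<le> 1" for j
    using assms(1) unit_cube_component [OF assms(2), of "e j"] e_le [of j]
    by (auto simp: cube_join_def)
  then show ?thesis
    by (simp add: mem_box_cart)
qed

lemma cube_split_in: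
  assumes "z \<in> cbox 0 1"
  shows "fst (cube_split e k z) \<in> {0..1}" "snd (cube_split e k z) \<in> topspace (unit_cube k)"
  using assms by (auto simp: cube_split_def topspace_unit_cube mem_box_cart)

lemma continuous_map_cube_join:
  "continuous_map (prod_topology (top_of_set {0..1}) (unit_cube k)) (top_of_set (cbox 0 1))
     (cube_join e k)"
proof -
  let ?P = "prod_topology (top_of_set {0..1}) (unit_cube k)"
  have fst: "continuous_map ?P euclideanreal fst"
    by (rule continuous_map_into_fulltopology [OF continuous_map_fst])
  have comp: "continuous_map ?P euclideanreal (\<lambda>p. snd p i)" if "i < k" for i
  proof -
    have "continuous_map (unit_cube k) (top_of_set {0..1}) (\<lambda>t. t i)"
      unfolding unit_cube_def using that by (intro continuous_map_product_projection) simp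
    then have "continuous_map (unit_cube k) euclideanreal (\<lambda>t. t i)"
      by (rule continuous_map_into_fulltopology)
    from continuous_map_compose [OF continuous_map_snd this] show ?thesis
      by (simp add: o_def)
  qed
  have "continuous_map ?P euclideanreal (\<lambda>p. cube_join e k p $ j)" for j
  proof (cases "e j = k")
    case True
    then show ?thesis
      using fst by (simp add: cube_join_def case_prod_unfold)
  next
    case False
    then show ?thesis
      using comp [of "e j"] e_le [of j] by (simp add: cube_join_def case_prod_unfold)
  qed
  then have "continuous_map ?P euclidean (cube_join e k)"
    by (simp add: continuous_map_atin vec_tendstoI)
  then show ?thesis
    using cube_join_in_cbox by (auto simp: continuous_map_in_subtopology)
qed

lemma continuous_map_cube_split:
  "continuous_map (top_of_set (cbox 0 1)) (prod_topology (top_of_set {0..1}) (unit_cube k))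
     (cube_split e k)"
proof -
  have comp: "continuous_map (top_of_set (cbox 0 1)) (top_of_set {0..1}) (\<lambda>z :: real ^ 'n. z $ j)" for j
    by (auto simp: mem_box_cart intro!: continuous_intros)
  have "continuous_map (top_of_set (cbox 0 1)) (unit_cube k) (\<lambda>z. snd (cube_split e k z))"
    unfolding unit_cube_def continuous_map_componentwise
    using comp by (auto simp: cube_split_def)
  moreover have "continuous_map (top_of_set (cbox 0 1)) (top_of_set {0..1}) (\<lambda>z. fst (cube_split e k z))"
    using comp by (simp add: cube_split_def)
  ultimately show ?thesis
    by (simp add: continuous_map_pairwise o_def)
qed

section \<open>Faces of the cube\<close>

lemma cube_join_side:
  assumes "s \<in> {0..1}" "t \<in> cube_boundary k"
  shows "cube_join e k (s, t) \<in> cbox 0 1"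
    "\<exists>j. e j \<noteq> k \<and> (cube_join e k (s, t) $ j = 0 \<or> cube_join e k (s, t) $ j = 1)"
proof -
  obtain i where i: "i < k" "t i = 0 \<or> t i = 1"
    using assms(2) by (auto simp: cube_boundary_def)
  show "cube_join e k (s, t) \<in> cbox 0 1"
    using assms by (intro cube_join_in_cbox) (auto simp: cube_boundary_def)
  show "\<exists>j. e j \<noteq> k \<and> (cube_join e k (s, t) $ j = 0 \<or> cube_join e k (s, t) $ j = 1)"
    using i by (intro exI [of _ "inv_into UNIV e i"]) (simp add: cube_join_def e_inv)
qed

lemma cube_split_side:
  assumes "z \<in> cbox 0 1" "e j \<noteq> k" "z $ j = 0 \<or> z $ j = 1"
  shows "snd (cube_split e k z) \<in> cube_boundary k"
proof -
  have "e j < k"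
    using assms(2) e_le [of j] by simp
  then have "snd (cube_split e k z) (e j) = z $ j"
    by (simp add: cube_split_def inv_e)
  then show ?thesis
    using cube_split_in(2) [OF assms(1)] \<open>e j < k\<close> assms(3) by (auto simp: cube_boundary_def)
qed

text \<open>All faces except the bottom one, on which coordinate number k is 0. A spheroid on the
  bottom face is extended over this set by a constant.\<close>

definition top_and_sides :: "(real ^ 'n) set" where
  "top_and_sides = {z \<in> cbox 0 1. \<exists>j. z $ j = 1 \<or> (e j \<noteq> k \<and> z $ j = 0)}"

lemma top_and_sides_subset: "top_and_sides \<subseteq> frontier (cbox 0 1)"
  by (auto simp: top_and_sides_def frontier_unit_cbox_cart)

lemma closed_top_and_sides: "closed top_and_sides"
proof -
  have "top_and_sides = cbox 0 1 \<inter> (\<Union>j. {z. z $ j = 1} \<union> (if e j = k then {} else {z. z $ j = 0}))"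
    by (auto simp: top_and_sides_def split: if_splits)
  moreover have "closed {z :: real ^ 'n. z $ j = c}" for j c
    by (intro closed_Collect_eq continuous_intros)
  ultimately show ?thesis
    by (auto intro!: closed_Int closed_UN)
qed

text \<open>The bottom face meets the other faces only in its own boundary, where a spheroid takes
  the base point; so pasting with a constant is consistent.\<close>

lemma top_and_sides_bottom:
  assumes "z \<in> top_and_sides" "z $ inv_into UNIV e k = 0"
  shows "snd (cube_split e k z) \<in> cube_boundary k"
proof -
  obtain j where z: "z \<in> cbox 0 1" and j: "z $ j = 1 \<or> (e j \<noteq> k \<and> z $ j = 0)"
    using assms(1) by (auto simp: top_and_sides_def)
  have "e j \<noteq> k"
    using j assms(2) inv_e [of j] by auto
  then show ?thesis
    using cube_split_side [OF z] j by blast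
qed

lemma frontier_cube_eq:
  "frontier (cbox 0 1) = {z \<in> cbox 0 1. z $ inv_into UNIV e k = 0} \<union> top_and_sides"
proof -
  have "e j \<noteq> k \<or> j = inv_into UNIV e k" for j
    using inv_e by auto
  then show ?thesis
    unfolding frontier_unit_cbox_cart top_and_sides_def by blast
qed

section \<open>Null-homotopies of spheroids as extensions from the boundary to the cube\<close>

lemma null_homotopic_spheroid:
  fixes x0 :: "real ^ 'd"
  assumes null: "all_maps_null (frontier (cbox 0 1) :: (real ^ 'n) set) (sphere (0 :: real ^ 'd) 1)"
    and x0: "x0 \<in> sphere 0 1" and f: "f \<in> spheroids k (top_of_set (sphere 0 1)) x0"
  shows "homotopic_with (\<lambda>h. \<forall>t\<in>cube_boundary k. h t = x0) (unit_cube k)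
           (top_of_set (sphere 0 1)) f (\<lambda>_. x0)"
proof -
  let ?p = "inv_into UNIV e k" and ?C = "cbox 0 1 :: (real ^ 'n) set"
  let ?B = "{z \<in> ?C. z $ ?p = 0}"
  let ?f = "\<lambda>z. f (snd (cube_split e k z))"
  \<comment> \<open>The spheroid on the bottom face and the base point on the others. An extension
    of \<open>g\<close> to the cube is a homotopy from \<open>f\<close> to the constant.\<close>
  define g where "g z = (if z $ ?p = 0 then ?f z else x0)" for z
  have fcont: "continuous_map (unit_cube k) (top_of_set (sphere 0 1)) f"
    and fbd: "\<And>t. t \<in> cube_boundary k \<Longrightarrow> f t = x0"
    using f by (auto simp: spheroids_def)
  have "continuous_map (top_of_set ?C) (top_of_set (sphere 0 1)) (f \<circ> (snd \<circ> cube_split e k))"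
    by (intro continuous_map_compose [OF _ fcont] continuous_map_compose [OF continuous_map_cube_split]
          continuous_map_snd)
  then have fC: "continuous_on ?C ?f" "?f ` ?C \<subseteq> sphere 0 1"
    by (auto simp: o_def)
  have g_top_and_sides: "g z = x0" if "z \<in> top_and_sides" for z
    using top_and_sides_bottom [OF that] fbd by (simp add: g_def)
  have closedB: "closed ?B"
    unfolding Collect_conj_eq Collect_mem_eq
    by (intro closed_Int closed_cbox closed_Collect_eq continuous_intros)
  have "continuous_on (?B \<union> top_and_sides) (\<lambda>z. if z $ ?p = 0 then ?f z else x0)"
  proof (rule continuous_on_cases_local)
    show "closedin (top_of_set (?B \<union> top_and_sides)) ?B"
      using closedB by (intro closed_subset) auto
    show "closedin (top_of_set (?B \<union> top_and_sides)) top_and_sides"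
      using closed_top_and_sides by (intro closed_subset) auto
    show "continuous_on ?B ?f"
      by (rule continuous_on_subset [OF fC(1)]) auto
    show "?f z = x0" if "z \<in> ?B \<and> z $ ?p \<noteq> 0 \<or> z \<in> top_and_sides \<and> z $ ?p = 0" for z
      using that top_and_sides_bottom fbd by auto
  qed simp
  then have gcont: "continuous_on (frontier ?C) g"
    unfolding frontier_cube_eq g_def .
  have gim: "g z \<in> sphere 0 1" if "z \<in> frontier ?C" for z
  proof -
    have "z \<in> ?C"
      using that by (simp add: frontier_unit_cbox_cart)
    then show ?thesis
      using fC(2) x0 unfolding g_def by (simp add: image_subset_iff)
  qed
  have bottom: "cube_join e k (0, t) \<in> frontier ?C" "g (cube_join e k (0, t)) = f t"
    if "t \<in> topspace (unit_cube k)" for t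
  proof -
    have "cube_join e k (0, t) $ ?p = 0"
      by (simp add: cube_join_def e_inv)
    then show "cube_join e k (0, t) \<in> frontier ?C" "g (cube_join e k (0, t)) = f t"
      using cube_join_in_cbox [of 0, OF _ that] cube_split_join [OF that]
      by (auto simp: frontier_unit_cbox_cart g_def)
  qed
  have top: "cube_join e k (1, t) \<in> top_and_sides" if "t \<in> topspace (unit_cube k)" for t
  proof -
    have "cube_join e k (1, t) $ ?p = 1"
      by (simp add: cube_join_def e_inv)
    then show ?thesis
      using cube_join_in_cbox [of 1, OF _ that] by (auto simp: top_and_sides_def)
  qed
  have side: "cube_join e k (s, t) \<in> top_and_sides" if "s \<in> {0..1}" "t \<in> cube_boundary k" for s t
    using cube_join_side [OF that] by (auto simp: top_and_sides_def)
  have "\<exists>c. homotopic_with_canon (\<lambda>x. True) (frontier ?C) (sphere 0 1) g (\<lambda>x. c)"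
    using null gcont gim unfolding all_maps_null_def by blast
  moreover have "frontier ?C \<noteq> {}"
    using bottom(1) [of "\<lambda>i\<in>{..<k}. 0"] by (auto simp: topspace_unit_cube)
  \<comment> \<open>The sphere is an ANR, so a null-homotopic map into it from a nonempty closed set
    extends to the whole space.\<close>
  ultimately obtain G where G: "continuous_on UNIV G" "range G \<subseteq> sphere 0 1" "\<forall>z\<in>frontier ?C. G z = g z"
    using nullhomotopic_into_ANR_extension [of "frontier ?C" g "sphere 0 1"] gcont gim
    by (auto simp: ANR_sphere image_subset_iff)
  have Gx0: "G z = x0" if "z \<in> top_and_sides" for z
    using that G(3) g_top_and_sides top_and_sides_subset by auto
  have "continuous_map (top_of_set ?C) (top_of_set (sphere 0 1)) G"
    using G(1,2) by (auto intro: continuous_on_subset)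
  then have "continuous_map (prod_topology (top_of_set {0..1}) (unit_cube k)) (top_of_set (sphere 0 1))
      (G \<circ> cube_join e k)"
    by (rule continuous_map_compose [OF continuous_map_cube_join])
  \<comment> \<open>The bottom face gives \<open>f\<close> at time 0, the top face \<open>x0\<close>
    at time 1, and the sides \<open>x0\<close> at all times.\<close>
  then show ?thesis
    unfolding homotopic_rel_cube_boundary
    using bottom G(3) Gx0 top side by (auto intro!: exI [of _ "G \<circ> cube_join e k"])
qed

text \<open>Deform \<open>g\<close> to a map \<open>g'\<close> constant off the bottom face and move
  that constant to \<open>x0\<close>; the bottom face then carries a spheroid. A null-homotopy of it
  extends the moved map to the cube, which is contractible, so the map is null-homotopic.\<close>

lemma all_maps_null_if_spheroids_null:
  fixes x0 :: "real ^ 'd"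
  assumes x0: "x0 \<in> sphere 0 1"
    and null: "\<And>f. f \<in> spheroids k (top_of_set (sphere 0 1)) x0 \<Longrightarrow>
      homotopic_with (\<lambda>h. \<forall>t\<in>cube_boundary k. h t = x0) (unit_cube k)
        (top_of_set (sphere 0 1)) f (\<lambda>_. x0)"
  shows "all_maps_null (frontier (cbox 0 1) :: (real ^ 'n) set) (sphere (0 :: real ^ 'd) 1)"
  unfolding all_maps_null_def
proof (intro allI impI, elim conjE)
  let ?p = "inv_into UNIV e k" and ?C = "cbox 0 1 :: (real ^ 'n) set"
  let ?X = "sphere (0 :: real ^ 'd) 1"
  fix g :: "real ^ 'n \<Rightarrow> real ^ 'd"
  assume g: "continuous_on (frontier ?C) g" "g \<in> frontier ?C \<rightarrow> ?X"
  \<comment> \<open>The centre of the bottom face. Removing it leaves a contractible set that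
    contains all the other faces.\<close>
  define q :: "real ^ 'n" where "q = (\<chi> j. if e j = k then 0 else 1/2)"
  have q: "q \<in> frontier ?C" "q \<notin> top_and_sides"
    unfolding frontier_cube_eq
    by (auto simp: q_def top_and_sides_def mem_box_cart e_inv split: if_splits)
  have "contractible (frontier ?C - {q})"
    by (rule contractible_punctured_cube_frontier [OF q(1)])
  then obtain c where "homotopic_with_canon (\<lambda>x. True) (frontier ?C - {q}) ?X g (\<lambda>x. c)"
    using g by (elim nullhomotopic_from_contractible [rotated 2]) (auto intro: continuous_on_subset)
  then have gc: "homotopic_with_canon (\<lambda>x. True) top_and_sides ?X g (\<lambda>x. c)"
    by (rule homotopic_with_subset_left) (use top_and_sides_subset q(2) in auto)
  \<comment> \<open>The homotopy forces \<open>c\<close> into the sphere only if its domain has a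
    point.\<close>
  have "(1 :: real ^ 'n) \<in> top_and_sides"
    by (auto simp: top_and_sides_def mem_box_cart)
  then have c: "c \<in> ?X"
    using homotopic_with_imp_subset2 [OF gc] by auto
  have "closedin (top_of_set (frontier ?C)) top_and_sides"
    by (intro closed_subset top_and_sides_subset closed_top_and_sides)
  \<comment> \<open>Borsuk's homotopy extension: the null-homotopy on the closed set
    \<open>top_and_sides\<close> extends to a homotopy of \<open>g\<close> on the whole boundary,
    the sphere being an ANR.\<close>
  then obtain g' where g': "homotopic_with_canon (\<lambda>x. True) (frontier ?C) ?X g g'"
      "continuous_on (frontier ?C) g'" "g' ` frontier ?C \<subseteq> ?X" "\<And>z. z \<in> top_and_sides \<Longrightarrow> g' z = c"
    using g gc ANR_sphere by (elim Borsuk_homotopy_extension_homotopic) auto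
  \<comment> \<open>An orthogonal map moves \<open>c\<close> to \<open>x0\<close> also in the
    0-sphere, where no path joins its two points.\<close>
  obtain R where R: "orthogonal_transformation R" "R c = x0"
    using orthogonal_transformation_exists [of c x0] c x0 by auto
  obtain R' where R': "orthogonal_transformation R'" "\<And>x. R' (R x) = x"
    using orthogonal_transformation_inv [OF R(1)] orthogonal_transformation_inj [OF R(1)]
    by (metis inv_f_f)
  have Rcont: "continuous_on S R" "continuous_on S R'" for S
    using R(1) R'(1)
    by (intro linear_continuous_on; simp add: linear_conv_bounded_linear [symmetric] orthogonal_transformation_linear)+
  have Rim: "R x \<in> ?X" "R' x \<in> ?X" if "x \<in> ?X" for x
    using that R(1) R'(1) by (simp_all add: orthogonal_transformation_norm)
  define f where "f t = R (g' (cube_join e k (0, t)))" for t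
  have bottom: "cube_join e k (0, t) \<in> frontier ?C" if "t \<in> topspace (unit_cube k)" for t
    unfolding frontier_cube_eq using cube_join_in_cbox [of 0, OF _ that]
    by (simp add: cube_join_def e_inv)
  have f: "f \<in> spheroids k (top_of_set ?X) x0"
  proof -
    have "continuous_map (unit_cube k) (prod_topology (top_of_set {0..1}) (unit_cube k)) (\<lambda>t. (0 :: real, t))"
      by (intro continuous_map_pairedI) auto
    then have "continuous_map (unit_cube k) (top_of_set ?C) (cube_join e k \<circ> (\<lambda>t. (0, t)))"
      by (rule continuous_map_compose [OF _ continuous_map_cube_join])
    then have "continuous_map (unit_cube k) (top_of_set (frontier ?C)) (\<lambda>t. cube_join e k (0, t))"
      using bottom by (auto simp: continuous_map_in_subtopology o_def)
    moreover have "continuous_map (top_of_set (frontier ?C)) (top_of_set ?X) (R \<circ> g')"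
    proof -
      have "continuous_on (frontier ?C) (R \<circ> g')"
        by (rule continuous_on_compose [OF g'(2) Rcont(1)])
      moreover have "(R \<circ> g') ` frontier ?C \<subseteq> ?X"
        using g'(3) Rim(1) by (simp add: image_subset_iff)
      ultimately show ?thesis
        by (simp add: continuous_map_in_subtopology image_subset_iff Pi_iff o_def)
    qed
    ultimately have "continuous_map (unit_cube k) (top_of_set ?X)
        ((R \<circ> g') \<circ> (\<lambda>t. cube_join e k (0, t)))"
      by (rule continuous_map_compose)
    then have "continuous_map (unit_cube k) (top_of_set ?X) f"
      by (simp add: f_def [abs_def] o_def)
    moreover have "f t = x0" if "t \<in> cube_boundary k" for t
    proof -
      have "cube_join e k (0, t) \<in> top_and_sides"
        using cube_join_side [of 0, OF _ that] by (auto simp: top_and_sides_def)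
      then show ?thesis
        by (simp add: f_def g'(4) R(2))
    qed
    ultimately show ?thesis
      by (simp add: spheroids_def)
  qed
  obtain h where "continuous_map (prod_topology (top_of_set {0..1::real}) (unit_cube k)) (top_of_set ?X) h \<and>
      (\<forall>t\<in>topspace (unit_cube k). h (0, t) = f t) \<and>
      (\<forall>t\<in>topspace (unit_cube k). h (1, t) = x0) \<and>
      (\<forall>s\<in>{0..1}. \<forall>t\<in>cube_boundary k. h (s, t) = x0)"
    using null [OF f] unfolding homotopic_rel_cube_boundary by (rule exE)
  note h = this [THEN conjunct1] this [THEN conjunct2, THEN conjunct1, rule_format]
    this [THEN conjunct2, THEN conjunct2, THEN conjunct1, rule_format]
    this [THEN conjunct2, THEN conjunct2, THEN conjunct2, rule_format]
  have "continuous_map (top_of_set ?C) (top_of_set ?X) (h \<circ> cube_split e k)"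
    by (rule continuous_map_compose [OF continuous_map_cube_split h(1)])
  then have hC: "continuous_on ?C (h \<circ> cube_split e k)" "(h \<circ> cube_split e k) \<in> ?C \<rightarrow> ?X"
    by auto
  \<comment> \<open>The null-homotopy read on the cube extends \<open>R\<close> after
    \<open>g'\<close>: on the bottom face by the choice of \<open>f\<close>, on the top and the
    sides because both maps are \<open>x0\<close> there.\<close>
  have eq: "h (cube_split e k z) = R (g' z)" if z: "z \<in> frontier ?C" for z
  proof -
    let ?s = "fst (cube_split e k z)" and ?t = "snd (cube_split e k z)"
    have zC: "z \<in> ?C" and "\<exists>j. z $ j = 0 \<or> z $ j = 1"
      using z by (auto simp: frontier_unit_cbox_cart)
    then obtain j where j: "z $ j = 0 \<or> z $ j = 1"
      by blast
    have st: "?s \<in> {0..1}" "?t \<in> topspace (unit_cube k)" "?s = z $ ?p"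
      using cube_split_in [OF zC] by (simp_all add: cube_split_def)
    have "z \<in> top_and_sides \<or> z $ ?p = 0"
      using z by (auto simp: frontier_cube_eq)
    then have "z $ ?p = 0 \<or> z $ ?p = 1 \<and> z \<in> top_and_sides \<or> e j \<noteq> k \<and> z \<in> top_and_sides"
      using j inv_e [of j] by auto
    then consider "z $ ?p = 0" | "z $ ?p = 1" "z \<in> top_and_sides" | "e j \<noteq> k" "z \<in> top_and_sides"
      by blast
    then show ?thesis
    proof cases
      case 1
      then have "h (cube_split e k z) = h (0, ?t)"
        using st(3) by (metis prod.collapse)
      also have "\<dots> = R (g' (cube_join e k (cube_split e k z)))"
        using 1 st by (simp add: h(2) f_def) (metis prod.collapse)
      finally show ?thesis
        by (simp add: cube_join_split)
    next
      case 2
      then have "h (cube_split e k z) = h (1, ?t)"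
        using st(3) by (metis prod.collapse)
      then show ?thesis
        using 2(2) st by (simp add: h(3) g'(4) R(2))
    next
      case 3
      have "h (cube_split e k z) = h (?s, ?t)"
        by simp
      also have "\<dots> = x0"
        using st(1) cube_split_side [OF zC 3(1) j] by (rule h(4))
      finally show ?thesis
        using 3(2) by (simp add: g'(4) R(2))
    qed
  qed
  \<comment> \<open>Contractibility of the cube makes the extension null-homotopic, hence also its
    restriction to the boundary. Composing with \<open>R'\<close> returns to
    \<open>g'\<close>.\<close>
  obtain d where "homotopic_with_canon (\<lambda>x. True) ?C ?X (h \<circ> cube_split e k) (\<lambda>x. d)"
    using nullhomotopic_from_contractible [OF hC convex_imp_contractible [OF convex_box(1)]] by blast
  then have "homotopic_with_canon (\<lambda>x. True) (frontier ?C) ?X (h \<circ> cube_split e k) (\<lambda>x. d)"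
    by (rule homotopic_with_subset_left) (auto simp: frontier_unit_cbox_cart)
  then have "homotopic_with_canon (\<lambda>x. True) (frontier ?C) ?X (R' \<circ> (h \<circ> cube_split e k)) (R' \<circ> (\<lambda>x. d))"
    by (rule homotopic_with_compose_continuous_left) (use Rcont Rim in auto)
  then have "homotopic_with_canon (\<lambda>x. True) (frontier ?C) ?X g' (\<lambda>x. R' d)"
    by (rule homotopic_with_eq) (auto simp: eq R'(2))
  then show "\<exists>c. homotopic_with_canon (\<lambda>x. True) (frontier ?C) ?X g (\<lambda>x. c)"
    using homotopic_with_trans [OF g'(1)] by blast
qed

end

text \<open>Based spheroids and free maps are compared on the boundary of the cube of dimension k +
  1, which is homeomorphic to the sphere.\<close>

theorem homotopy_group_trivial_iff:
  fixes x0 :: "real ^ 'd"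
  assumes e: "bij_betw (e :: 'n::finite \<Rightarrow> nat) UNIV {..k}" and x0: "x0 \<in> sphere 0 1"
  shows "carrier (homotopy_group k (top_of_set (sphere 0 1)) x0) =
      {\<one>\<^bsub>homotopy_group k (top_of_set (sphere 0 1)) x0\<^esub>} \<longleftrightarrow>
    all_maps_null (sphere (0 :: real ^ 'n) 1) (sphere (0 :: real ^ 'd) 1)"
proof -
  have "all_maps_null (sphere (0 :: real ^ 'n) 1) (sphere (0 :: real ^ 'd) 1) \<longleftrightarrow>
      all_maps_null (frontier (cbox 0 1) :: (real ^ 'n) set) (sphere (0 :: real ^ 'd) 1)"
    by (intro all_maps_null_domain_cong homeomorphic_imp_homotopy_eqv sphere_homeomorphic_cube_frontier)
  moreover have "\<dots> \<longleftrightarrow> (\<forall>f\<in>spheroids k (top_of_set (sphere 0 1)) x0.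
      homotopic_with (\<lambda>h. \<forall>t\<in>cube_boundary k. h t = x0) (unit_cube k)
        (top_of_set (sphere 0 1)) f (\<lambda>_. x0))"
    using null_homotopic_spheroid [OF e _ x0] all_maps_null_if_spheroids_null [OF e x0] by blast
  ultimately show ?thesis
    using spheroids_trivial_iff [of x0 "top_of_set (sphere 0 1)" k] x0 by simp
qed

text \<open>Both sides say that some map from the k-sphere to the (m-1)-sphere is not
  null-homotopic. Dimensions are encoded as cardinalities of index types.\<close>

theorem corollary3p2:
  fixes k m :: nat and x0 :: "real ^ 'd"
  assumes "k \<ge> 1" and "m \<ge> 1"
    and "CARD('n::finite) = k + 1" and "CARD('d::finite) = m"
    and "x0 \<in> sphere 0 1"
  shows "(\<exists>S. cover m (sphere (0 :: real ^ 'n) 1) S \<and> (\<Inter>i\<le>m. S i) = {} \<and>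
            (\<forall>F. cover m (cball (0 :: real ^ 'n) 1) F \<and>
                 cover_extends m (cball 0 1) F (sphere 0 1) S \<longrightarrow> (\<Inter>i\<le>m. F i) \<noteq> {}))
         \<longleftrightarrow>
         carrier (homotopy_group k (top_of_set (sphere (0 :: real ^ 'd) 1)) x0)
           \<noteq> {\<one>\<^bsub>homotopy_group k (top_of_set (sphere 0 1)) x0\<^esub>}"
proof -
  obtain e :: "'d \<Rightarrow> nat" where e: "bij_betw e UNIV {..<m}"
    using finite_same_card_bij [of "UNIV :: 'd set" "{..<m}"] assms(4) by auto
  obtain e' :: "'n \<Rightarrow> nat" where e': "bij_betw e' UNIV {..k}"
    using finite_same_card_bij [of "UNIV :: 'n set" "{..k}"] assms(3) by auto
  \<comment> \<open>This is where k is positive: the k-sphere has to be connected.\<close>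
  have "2 \<le> DIM(real ^ 'n)"
    using assms(1,3) by simp
  then show ?thesis
    by (simp only: covers_iff_not_all_maps_null [OF e] homotopy_group_trivial_iff [OF e' assms(5)]
          all_maps_null_punctured)
qed

end
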